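(* Let $\mathbf{k}$ be a commutative ring, $V$ a set with $n$ elements, and for each $a\in V\times V$ let $t_a\in\mathbf{k}$ and $s_a:=t_a+1$. Then \[\widetilde{U}_t=\sum_{\sigma\in\mathfrak{S}_V}\left(\prod_{\gamma\text{ a cycle of }\sigma}\Bigl(\prod_{a\in\operatorname{CArcs}\gamma}s_a-\prod_{a\in\operatorname{CArcs}\gamma}t_a\Bigr)\right)p_{\operatorname{type}\sigma}.\]
   Context: A $V$-listing is a tuple $w=(w_1,\dots,w_n)$ containing each element of $V$ exactly once. The deformed Redei--Berge symmetric function is $\widetilde{U}_t=\sum_{w}\sum_{i_1\le i_2\le\cdots\le i_n}\Bigl(\prod_{k\in[n-1],\,i_k=i_{k+1}}s_{(w_k,w_{k+1})}\Bigr)x_{i_1}x_{i_2}\cdots x_{i_n}\in\mathbf{k}[[x_1,x_2,\dots]]$, where $w$ ranges over $V$-listings and $i_1,\dots,i_n$ over positive integers. The cycles of $\sigma\in\mathfrak{S}_V$ are the rotation-equivalence classes (under cyclic rotation) of tuples $(i,\sigma(i),\dots,\sigma^{k-1}(i))$ with $k$ minimal such that $\sigma^k(i)=i$ (including cycles of length $1$); for the class $\gamma$ of $(v_1,\dots,v_k)$, $\operatorname{CArcs}\gamma=\{(v_1,v_2),\dots,(v_{k-1},v_k),(v_k,v_1)\}$. $\operatorname{type}\sigma$ is the partition of cycle lengths of $\sigma$; $p_m=x_1^m+x_2^m+\cdots$, $p_\lambda=\prod_j p_{\lambda_j}$. *)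

theory Defs
  imports
    "HOL-Library.Multiset"
    "HOL-Combinatorics.Cycles"
    "HOL-Combinatorics.Multiset_Permutations"
begin

section \<open>Formal power series in countably many commuting variables\<close>

text \<open>
  A monomial is a multiset of variable indices. The variables are indexed by all natural numbers;
  every construction below uses only the indices \<open>i \<ge> 1\<close>.

  The coefficients range over the sort \<open>{comm_ring, comm_monoid_mult}\<close>, that is, over arbitrary
  commutative rings with unity; unlike \<open>comm_ring_1\<close> this does not exclude the zero ring.
\<close>

typedef 'k mfps = "UNIV :: (nat multiset \<Rightarrow> 'k) set"
  morphisms mfps_coeff Abs_mfps ..

setup_lifting type_definition_mfps

lemma mfps_eqI: "(\<And>m. mfps_coeff f m = mfps_coeff g m) \<Longrightarrow> f = g"
  by (metis ext mfps_coeff_inject)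

lemma finite_submultisets: "finite {a. a \<subseteq># (m :: 'a multiset)}"
proof (induction m)
  case empty
  then show ?case by simp
next
  case (add x m)
  have "a \<in> {a. a \<subseteq># m} \<union> add_mset x ` {a. a \<subseteq># m}" if "a \<subseteq># add_mset x m" for a
  proof (cases "x \<in># a")
    case True
    then obtain b where b: "a = add_mset x b" by (metis mset_add)
    then show ?thesis using that by simp
  next
    case False
    then show ?thesis using that
      by (metis (no_types, lifting) UnI1 diff_single_trivial mem_Collect_eq subset_eq_diff_conv
          add_mset_add_single)
  qed
  then have "{a. a \<subseteq># add_mset x m} \<subseteq> {a. a \<subseteq># m} \<union> add_mset x ` {a. a \<subseteq># m}"
    by blast
  then show ?case using add.IH by (meson finite_UnI finite_imageI finite_subset)
qed

lemma finite_mset_antidiagonal: "finite {(a, b). a + b = (m :: 'a multiset)}"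
proof -
  have "{(a, b). a + b = m} \<subseteq> {a. a \<subseteq># m} \<times> {a. a \<subseteq># m}" by auto
  then show ?thesis by (rule finite_subset) (simp add: finite_submultisets)
qed

lemma sum_mset_antidiagonal_assoc:
  fixes f :: "'a multiset \<Rightarrow> 'a multiset \<Rightarrow> 'a multiset \<Rightarrow> 'k::comm_monoid_add"
  shows "(\<Sum>(u, c)\<in>{(u, c). u + c = m}. \<Sum>(a, b)\<in>{(a, b). a + b = u}. f a b c) =
         (\<Sum>(a, v)\<in>{(a, v). a + v = m}. \<Sum>(b, c)\<in>{(b, c). b + c = v}. f a b c)"
proof -
  have "(\<Sum>(u, c)\<in>{(u, c). u + c = m}. \<Sum>(a, b)\<in>{(a, b). a + b = u}. f a b c) =
        (\<Sum>p\<in>(SIGMA p:{(u, c). u + c = m}. {(a, b). a + b = fst p}).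
           f (fst (snd p)) (snd (snd p)) (snd (fst p)))"
    using sum.Sigma[of "{(u, c). u + c = m}" "\<lambda>p. {(a, b). a + b = fst p}"
        "\<lambda>p q. f (fst q) (snd q) (snd p)"]
    by (simp add: split_def finite_mset_antidiagonal[unfolded split_def])
  also have "\<dots> = (\<Sum>p\<in>(SIGMA p:{(a, v). a + v = m}. {(b, c). b + c = snd p}).
           f (fst (fst p)) (fst (snd p)) (snd (snd p)))"
    by (rule sum.reindex_bij_witness[where
          i = "\<lambda>p. ((fst (fst p) + fst (snd p), snd (snd p)), (fst (fst p), fst (snd p)))" and
          j = "\<lambda>p. ((fst (snd p), snd (snd p) + snd (fst p)), (snd (snd p), snd (fst p)))"])
       (auto simp: add.assoc)
  also have "\<dots> = (\<Sum>(a, v)\<in>{(a, v). a + v = m}. \<Sum>(b, c)\<in>{(b, c). b + c = v}. f a b c)"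
    using sum.Sigma[of "{(a, v). a + v = m}" "\<lambda>p. {(b, c). b + c = snd p}"
        "\<lambda>p q. f (fst p) (fst q) (snd q)"]
    by (simp add: split_def finite_mset_antidiagonal[unfolded split_def])
  finally show ?thesis .
qed

instantiation mfps :: (comm_ring) comm_ring
begin

lift_definition zero_mfps :: "'a mfps" is "\<lambda>_. 0" .
lift_definition plus_mfps :: "'a mfps \<Rightarrow> 'a mfps \<Rightarrow> 'a mfps" is "\<lambda>f g m. f m + g m" .
lift_definition minus_mfps :: "'a mfps \<Rightarrow> 'a mfps \<Rightarrow> 'a mfps" is "\<lambda>f g m. f m - g m" .
lift_definition uminus_mfps :: "'a mfps \<Rightarrow> 'a mfps" is "\<lambda>f m. - f m" .
lift_definition times_mfps :: "'a mfps \<Rightarrow> 'a mfps \<Rightarrow> 'a mfps" is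
  "\<lambda>f g m. \<Sum>(a, b)\<in>{(a, b). a + b = m}. f a * g b" .

instance
proof
  fix f g h :: "'a mfps"
  show "f * g * h = f * (g * h)"
  proof (rule mfps_eqI)
    fix m
    have "mfps_coeff (f * g * h) m =
      (\<Sum>(u, c)\<in>{(u, c). u + c = m}. \<Sum>(a, b)\<in>{(a, b). a + b = u}.
         mfps_coeff f a * mfps_coeff g b * mfps_coeff h c)"
      by (simp add: times_mfps.rep_eq sum_distrib_right split_def)
    also have "\<dots> = (\<Sum>(a, v)\<in>{(a, v). a + v = m}. \<Sum>(b, c)\<in>{(b, c). b + c = v}.
         mfps_coeff f a * mfps_coeff g b * mfps_coeff h c)"
      by (rule sum_mset_antidiagonal_assoc)
    also have "\<dots> = mfps_coeff (f * (g * h)) m"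
      by (simp add: times_mfps.rep_eq sum_distrib_left split_def mult.assoc)
    finally show "mfps_coeff (f * g * h) m = mfps_coeff (f * (g * h)) m" .
  qed
  show "f * g = g * f"
  proof (rule mfps_eqI)
    fix m
    show "mfps_coeff (f * g) m = mfps_coeff (g * f) m"
      unfolding times_mfps.rep_eq
      by (rule sum.reindex_bij_witness[where i = prod.swap and j = prod.swap])
         (auto simp: mult.commute add.commute)
  qed
  show "(f + g) * h = f * h + g * h"
    by (rule mfps_eqI)
       (simp add: times_mfps.rep_eq plus_mfps.rep_eq distrib_right split_def sum.distrib)
qed (transfer; simp add: fun_eq_iff algebra_simps)+

end

instantiation mfps :: ("{comm_ring, comm_monoid_mult}") comm_monoid_mult
begin

lift_definition one_mfps :: "'a mfps" is "\<lambda>m. if m = {#} then 1 else 0" .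

instance
proof
  fix f :: "'a mfps"
  show "1 * f = f"
  proof (rule mfps_eqI)
    fix m
    have "mfps_coeff (1 * f) m =
        (\<Sum>p\<in>{(a, b). a + b = m}. if p = ({#}, m) then mfps_coeff f m else 0)"
      unfolding times_mfps.rep_eq one_mfps.rep_eq by (rule sum.cong) (auto split: if_splits)
    also have "\<dots> = mfps_coeff f m"
      by (subst sum.delta) (auto simp: finite_mset_antidiagonal)
    finally show "mfps_coeff (1 * f) m = mfps_coeff f m" .
  qed
qed

end

instance mfps :: (comm_ring_1) comm_ring_1
proof
  have "mfps_coeff (0 :: 'a mfps) {#} \<noteq> mfps_coeff 1 {#}"
    by (simp add: zero_mfps.rep_eq one_mfps.rep_eq)
  then show "(0 :: 'a mfps) \<noteq> 1" by metis
qed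

lift_definition mfps_const :: "'k \<Rightarrow> 'k::zero mfps" is "\<lambda>c m. if m = {#} then c else 0" .

lift_definition mfps_X :: "nat \<Rightarrow> 'k::{zero, one} mfps" is
  "\<lambda>i m. if m = {#i#} then 1 else 0" .

definition mfps_summable :: "('b \<Rightarrow> 'k::comm_monoid_add mfps) \<Rightarrow> 'b set \<Rightarrow> bool" where
  "mfps_summable f A \<longleftrightarrow> (\<forall>m. finite {a \<in> A. mfps_coeff (f a) m \<noteq> 0})"

text \<open>
  Infinite sums are taken coefficientwise. For a summable family each coefficient is a finite sum;
  the families used below are shown to be summable.
\<close>

lift_definition mfps_infsum :: "('b \<Rightarrow> 'k::comm_monoid_add mfps) \<Rightarrow> 'b set \<Rightarrow> 'k mfps" is
  "\<lambda>f A m. \<Sum>a\<in>{a \<in> A. f a m \<noteq> 0}. f a m" .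


section \<open>Power sum symmetric functions\<close>

definition power_sum :: "nat \<Rightarrow> 'k::{comm_ring, comm_monoid_mult} mfps" where
  "power_sum k = mfps_infsum (\<lambda>i. mfps_X i ^ k) {1..}"

definition power_sum_partition :: "nat multiset \<Rightarrow> 'k::{comm_ring, comm_monoid_mult} mfps" where
  "power_sum_partition \<mu> = (\<Prod>k\<in>#\<mu>. power_sum k)"


section \<open>Cycles of a permutation\<close>

definition rotation_class :: "'v list \<Rightarrow> 'v list set" where
  "rotation_class v = {rotate j v | j. True}"

text \<open>
  \<open>support \<sigma> i\<close> is the list \<open>[i, \<sigma> i, \<dots>, (\<sigma> ^^ (k - 1)) i]\<close> with \<open>k > 0\<close> minimal
  such that \<open>(\<sigma> ^^ k) i = i\<close>; it is \<open>[i]\<close> if \<open>i\<close> is a fixed point.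
\<close>

definition cycles :: "'v set \<Rightarrow> ('v \<Rightarrow> 'v) \<Rightarrow> 'v list set set" where
  "cycles V \<sigma> = {rotation_class (support \<sigma> i) | i. i \<in> V}"

definition list_CArcs :: "'v list \<Rightarrow> ('v \<times> 'v) set" where
  "list_CArcs v = {(v ! j, v ! (Suc j mod length v)) | j. j < length v}"

text \<open>
  On a rotation class \<open>list_CArcs\<close> and \<open>length\<close> are constant, so \<open>the_elem\<close> picks the value
  at any representative.
\<close>

definition CArcs :: "'v list set \<Rightarrow> ('v \<times> 'v) set" where
  "CArcs \<gamma> = the_elem (list_CArcs ` \<gamma>)"

definition cycle_length :: "'v list set \<Rightarrow> nat" where
  "cycle_length \<gamma> = the_elem (length ` \<gamma>)"

definition cycle_type :: "'v set \<Rightarrow> ('v \<Rightarrow> 'v) \<Rightarrow> nat multiset" where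
  "cycle_type V \<sigma> = image_mset cycle_length (mset_set (cycles V \<sigma>))"

lemma list_CArcs_rotate: "list_CArcs (rotate i v) = list_CArcs v"
proof -
  have sub: "list_CArcs (rotate1 u) \<subseteq> list_CArcs u" for u :: "'v list"
  proof
    fix a assume "a \<in> list_CArcs (rotate1 u)"
    then obtain j where j: "j < length u"
      "a = (rotate1 u ! j, rotate1 u ! (Suc j mod length u))"
      by (auto simp: list_CArcs_def)
    have l: "Suc j mod length u < length u" using j(1) by (intro mod_less_divisor) linarith
    have "a = (u ! (Suc j mod length u), u ! (Suc (Suc j mod length u) mod length u))"
      using j l nth_rotate1[of j u] nth_rotate1[of "Suc j mod length u" u] by simp
    then show "a \<in> list_CArcs u" using l by (auto simp: list_CArcs_def)
  qed
  have mono: "list_CArcs (rotate k u) \<subseteq> list_CArcs u" for k and u :: "'v list"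
    by (induction k) (use sub in \<open>auto dest: subsetD\<close>)
  show ?thesis
  proof
    show "list_CArcs (rotate i v) \<subseteq> list_CArcs v" by (rule mono)
    have "\<exists>k. rotate k (rotate i v) = v"
    proof (cases "v = []")
      case False
      then have "i \<le> i * length v" by (cases v) auto
      then have "rotate (i * length v - i) (rotate i v) = v" by (simp add: rotate_rotate)
      then show ?thesis by (rule exI)
    qed simp
    then obtain k where "rotate k (rotate i v) = v" ..
    then show "list_CArcs v \<subseteq> list_CArcs (rotate i v)" using mono[of k "rotate i v"] by simp
  qed
qed

lemma CArcs_rotation_class: "CArcs (rotation_class v) = list_CArcs v"
proof -
  have "list_CArcs ` rotation_class v = {list_CArcs v}"
    unfolding rotation_class_def image_def using list_CArcs_rotate by blast
  then show ?thesis by (simp add: CArcs_def)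
qed

lemma cycle_length_rotation_class: "cycle_length (rotation_class v) = length v"
proof -
  have "length ` rotation_class v = {length v}"
    unfolding rotation_class_def image_def by (auto intro: length_rotate[symmetric])
  then show ?thesis by (simp add: cycle_length_def)
qed


section \<open>The deformed Redei--Berge symmetric function\<close>

text \<open>Positions in lists are counted from \<open>0\<close>, so \<open>k\<close> here is one less than in \<open>k \<in> [n - 1]\<close>.\<close>

definition deformed_redei_berge ::
  "'v set \<Rightarrow> ('v \<times> 'v \<Rightarrow> 'k) \<Rightarrow> 'k::{comm_ring, comm_monoid_mult} mfps" where
  "deformed_redei_berge V t =
    (let s = (\<lambda>a. t a + 1) in
     \<Sum>w\<in>permutations_of_set V.
       mfps_infsum
         (\<lambda>is. mfps_const (\<Prod>k\<in>{k. Suc k < card V \<and> is ! k = is ! Suc k}. s (w ! k, w ! Suc k)) *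
                (\<Prod>i\<leftarrow>is. mfps_X i))
         {is. length is = card V \<and> sorted is \<and> (\<forall>i\<in>set is. 1 \<le> i)})"

lemma mfps_coeff_const_mult:
  "mfps_coeff (mfps_const c * f) m = (c :: 'k::comm_ring) * mfps_coeff f m"
proof -
  have "mfps_coeff (mfps_const c * f) m =
      (\<Sum>p\<in>{(a, b). a + b = m}. if p = ({#}, m) then c * mfps_coeff f m else 0)"
    unfolding times_mfps.rep_eq mfps_const.rep_eq by (rule sum.cong) (auto split: if_splits)
  also have "\<dots> = c * mfps_coeff f m"
    by (subst sum.delta) (auto simp: finite_mset_antidiagonal)
  finally show ?thesis .
qed

lemma mfps_coeff_X_mult:
  "mfps_coeff (mfps_X i * f) m =
    (if i \<in># m then mfps_coeff f (m - {#i#}) else (0 :: 'k::{comm_ring, comm_monoid_mult}))"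
proof -
  have "mfps_coeff (mfps_X i * f) m =
      (\<Sum>p\<in>{(a, b). a + b = m}.
         if p = ({#i#}, m - {#i#}) then mfps_coeff f (m - {#i#}) else 0)"
    unfolding times_mfps.rep_eq mfps_X.rep_eq by (rule sum.cong) (auto split: if_splits)
  also have "\<dots> = (if i \<in># m then mfps_coeff f (m - {#i#}) else 0)"
    by (subst sum.delta) (auto simp: finite_mset_antidiagonal)
  finally show ?thesis .
qed

lemma mfps_coeff_monomial:
  "mfps_coeff (\<Prod>i\<leftarrow>is. mfps_X i) m =
    (if m = mset is then 1 else (0 :: 'k::{comm_ring, comm_monoid_mult}))"
proof (induction "is" arbitrary: m)
  case Nil
  then show ?case by (simp add: one_mfps.rep_eq)
next
  case (Cons i "is")
  then show ?case by (auto simp: mfps_coeff_X_mult dest!: insert_DiffM)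
qed

lemma deformed_redei_berge_summable:
  "mfps_summable
     (\<lambda>is. mfps_const (c is :: 'k::{comm_ring, comm_monoid_mult}) * (\<Prod>i\<leftarrow>is. mfps_X i))
     {is. length is = n \<and> sorted is \<and> (\<forall>i\<in>set is. 1 \<le> i)}"
  unfolding mfps_summable_def
proof
  fix m :: "nat multiset"
  have "{is. mset is = m \<and> sorted is} \<subseteq> {sorted_list_of_multiset m}"
    by (auto simp: sorted_sort_id)
  then have "finite {is. mset is = m \<and> sorted is}" by (rule finite_subset) simp
  then show "finite {is \<in> {is. length is = n \<and> sorted is \<and> (\<forall>i\<in>set is. 1 \<le> i)}.
      mfps_coeff (mfps_const (c is) * (\<Prod>i\<leftarrow>is. mfps_X i)) m \<noteq> 0}"
    by (rule rev_finite_subset) (auto simp: mfps_coeff_const_mult mfps_coeff_monomial split: if_splits)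
qed

lemma power_sum_summable:
  assumes "k > 0"
  shows "mfps_summable (\<lambda>i. mfps_X i ^ k :: 'k::{comm_ring, comm_monoid_mult} mfps) {1..}"
  unfolding mfps_summable_def
proof
  fix m :: "nat multiset"
  have "i \<in># m" if "mfps_coeff (mfps_X i ^ k :: 'k mfps) m \<noteq> 0" for i
    using that assms by (cases k) (auto simp: mfps_coeff_X_mult split: if_splits)
  then have "{i \<in> {1..}. mfps_coeff (mfps_X i ^ k :: 'k mfps) m \<noteq> 0} \<subseteq> set_mset m" by auto
  then show "finite {i \<in> {1..}. mfps_coeff (mfps_X i ^ k :: 'k mfps) m \<noteq> 0}"
    by (rule finite_subset) simp
qed

end

theory Submission
  imports Defs
begin

text \<open>
  Call \<open>H(S)\<close> the sum over all listings of \<open>S\<close> of the product of \<open>s = t + 1\<close> over consecutive pairs,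
  and \<open>P(S)\<close> the sum over all permutations of \<open>S\<close> of the product over the cycles \<open>\<gamma>\<close> of
  \<open>s(\<gamma>) - t(\<gamma>)\<close>. For \<open>v \<notin> S\<close>, splitting off the cycle through \<open>v\<close> expresses \<open>P(S \<union> {v})\<close> by the
  values of \<open>P\<close> on subsets of \<open>S\<close>; telescoping \<open>s = t + 1\<close> along the part of a listing that precedes
  \<open>v\<close> shows that \<open>H\<close> satisfies the same recursion. Hence \<open>H(S) = P(S)\<close> for every weight \<open>t\<close>.

  The coefficient of a monomial is a sum over the colourings \<open>f\<close> of \<open>V\<close> with that content. For fixed
  \<open>f\<close>, replace \<open>t(x, y)\<close> by \<open>0\<close> if \<open>f x < f y\<close> and by \<open>-1\<close> if \<open>f x > f y\<close>. Then \<open>H(V)\<close> becomes the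
  contribution of \<open>f\<close> to the left-hand side and \<open>P(V)\<close> its contribution to the right-hand side.
\<close>

section \<open>Listings\<close>

fun path_weight :: "('v \<times> 'v \<Rightarrow> 'k::comm_monoid_mult) \<Rightarrow> 'v list \<Rightarrow> 'k" where
  "path_weight f (x # y # l) = f (x, y) * path_weight f (y # l)"
| "path_weight f l = 1"

lemma path_weight_split:
  "path_weight f (a @ v # b) = path_weight f (a @ [v]) * path_weight f (v # b)"
  by (induction f a rule: path_weight.induct) (auto simp: mult.assoc neq_Nil_conv)

text \<open>Truncated subtraction makes the index range empty for the empty list, in agreement with
  the default value 1 of \<open>path_weight\<close>.\<close>

lemma path_weight_conv_prod:
  "path_weight f l = (\<Prod>k<length l - 1. f (l ! k, l ! Suc k))"
  by (induction f l rule: path_weight.induct)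
    (simp_all add: prod.lessThan_Suc_shift del: prod.lessThan_Suc)

text \<open>Split at the last step whose factor \<open>t + 1\<close> contributes \<open>1\<close> rather than \<open>t\<close>.\<close>

lemma path_weight_telescope:
  fixes t :: "'v \<times> 'v \<Rightarrow> 'k::{comm_ring, comm_monoid_mult}"
  shows "path_weight (\<lambda>a. t a + 1) (l @ [v]) =
    (\<Sum>j\<le>length l. path_weight (\<lambda>a. t a + 1) (take j l) * path_weight t (drop j l @ [v]))"
proof (induction l)
  case (Cons x l)
  show ?case
  proof (cases l)
    case (Cons y l')
    define s where "s = (\<lambda>a. t a + 1)"
    \<comment> \<open>The terms \<open>j = 0\<close> and \<open>j = 1\<close> are
      \<open>t (x, y)\<close> and 1 times the same factor, so they merge into one term with factor
      \<open>s (x, y)\<close>. All later terms contain \<open>s (x, y)\<close> already.\<close>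
    have "(\<Sum>j\<le>length (x # l). path_weight s (take j (x # l)) * path_weight t (drop j (x # l) @ [v])) =
      t (x, y) * path_weight t (l @ [v]) + (path_weight t (l @ [v]) +
      (\<Sum>j\<le>length l'. s (x, y) * (path_weight s (take (Suc j) l) * path_weight t (drop (Suc j) l @ [v]))))"
      by (simp add: sum.atMost_Suc_shift Cons mult.assoc del: sum.atMost_Suc)
    also have "\<dots> = s (x, y) * path_weight t (l @ [v]) + s (x, y) *
      (\<Sum>j\<le>length l'. path_weight s (take (Suc j) l) * path_weight t (drop (Suc j) l @ [v]))"
      by (simp add: s_def distrib_right add.assoc sum_distrib_left)
    also have "\<dots> = s (x, y) * (\<Sum>j\<le>length l. path_weight s (take j l) * path_weight t (drop j l @ [v]))"
      by (simp add: sum.atMost_Suc_shift Cons distrib_left del: sum.atMost_Suc)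
    also have "\<dots> = path_weight s ((x # l) @ [v])"
      using Cons.IH by (simp add: Cons s_def)
    finally show ?thesis by (simp add: s_def)
  qed (simp add: add.commute)
qed simp

text \<open>Repeating the head closes the path, so the consecutive pairs are exactly the arcs of the
  cycle, including the loop at \<open>x\<close> for \<open>l = [x]\<close>.\<close>

definition cycle_weight :: "('v \<times> 'v \<Rightarrow> 'k::{comm_ring, comm_monoid_mult}) \<Rightarrow> 'v list \<Rightarrow> 'k" where
  "cycle_weight t l = path_weight (\<lambda>a. t a + 1) (l @ [hd l]) - path_weight t (l @ [hd l])"

text \<open>Telescoping the closed path gives one term without any chosen 1, the full product of the
  \<open>t\<close>. The subtraction in \<open>cycle_weight\<close> cancels it; what remains is
  indexed by the place of the last chosen 1.\<close>

lemma cycle_weight_Cons: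
  "cycle_weight t (v # u) =
    (\<Sum>j\<le>length u. path_weight (\<lambda>a. t a + 1) (v # take j u) * path_weight t (drop j u @ [v]))"
proof -
  have "path_weight (\<lambda>a. t a + 1) ((v # u) @ [v]) = path_weight t ((v # u) @ [v]) +
    (\<Sum>j\<le>length u. path_weight (\<lambda>a. t a + 1) (v # take j u) * path_weight t (drop j u @ [v]))"
    unfolding path_weight_telescope by (simp add: sum.atMost_Suc_shift del: sum.atMost_Suc)
  then show ?thesis by (simp add: cycle_weight_def)
qed

text \<open>Distinctness makes the arcs at different positions different, so the product over the
  set of arcs loses no factor compared with the product along the closed path.\<close>

lemma prod_list_CArcs:
  assumes "distinct l" "l \<noteq> []"
  shows "(\<Prod>a\<in>list_CArcs l. f a) = path_weight f (l @ [hd l])"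
proof -
  have *: "(l @ [hd l]) ! k = l ! k" "(l @ [hd l]) ! Suc k = l ! (Suc k mod length l)"
    if "k < length l" for k
    using that assms by (auto simp: nth_append mod_Suc hd_conv_nth)
  have "list_CArcs l = (\<lambda>k. (l ! k, l ! (Suc k mod length l))) ` {..<length l}"
    by (auto simp: list_CArcs_def)
  moreover have "inj_on (\<lambda>k. (l ! k, l ! (Suc k mod length l))) {..<length l}"
    using assms by (auto simp: inj_on_def nth_eq_iff_index_eq)
  ultimately show ?thesis
    by (simp add: path_weight_conv_prod prod.reindex *)
qed

lemma finite_list_triples:
  assumes "finite S"
  shows "finite {(a, b, c). distinct (a @ b @ c) \<and> set (a @ b @ c) = S}" (is "finite ?X")
proof -
  let ?L = "{a. set a \<subseteq> S \<and> length a \<le> card S}"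
  have fin: "finite ?L"
    using assms by (rule finite_lists_length_le)
  have "(a, b, c) \<in> ?L \<times> ?L \<times> ?L"
    if d: "distinct (a @ b @ c)" and st: "set (a @ b @ c) = S" for a b c
  proof -
    have "length (a @ b @ c) = card S" using distinct_card[OF d] st by simp
    then show ?thesis using st by auto
  qed
  then have "?X \<subseteq> ?L \<times> ?L \<times> ?L" by blast
  then show ?thesis by (rule finite_subset) (use fin in auto)
qed

lemma finite_distinct_lists_subset:
  assumes "finite S"
  shows "finite {u. distinct u \<and> set u \<subseteq> S}"
proof (rule finite_subset)
  show "{u. distinct u \<and> set u \<subseteq> S} \<subseteq> {u. set u \<subseteq> S \<and> length u \<le> card S}"
    by (clarsimp simp: card_mono[OF assms] simp flip: distinct_card)
  show "finite {u. set u \<subseteq> S \<and> length u \<le> card S}"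
    using assms by (rule finite_lists_length_le)
qed

section \<open>The recursion for sums over listings\<close>

definition path_sum :: "('v \<times> 'v \<Rightarrow> 'k::{comm_ring, comm_monoid_mult}) \<Rightarrow> 'v set \<Rightarrow> 'k" where
  "path_sum t S = (\<Sum>w\<in>permutations_of_set S. path_weight (\<lambda>a. t a + 1) w)"

lemma takeWhile_append_notin: "v \<notin> set a \<Longrightarrow> takeWhile (\<lambda>x. x \<noteq> v) (a @ v # b) = a"
  by (induction a) auto

lemma dropWhile_append_notin: "v \<notin> set a \<Longrightarrow> dropWhile (\<lambda>x. x \<noteq> v) (a @ v # b) = v # b"
  by (induction a) auto

text \<open>
  Both sides expand to a sum over all \<open>(a, b, c)\<close> whose concatenation lists \<open>S\<close>: on the left the
  listing is \<open>a @ b @ v # c\<close>, on the right the cycle is \<open>v # c @ b\<close> and \<open>a\<close> lists the rest.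
\<close>

lemma path_sum_insert:
  assumes "finite S" "v \<notin> S"
  shows "path_sum t (insert v S) =
    (\<Sum>u | distinct u \<and> set u \<subseteq> S. cycle_weight t (v # u) * path_sum t (S - set u))"
proof -
  define s where "s = (\<lambda>a. t a + 1)"
  define X where "X = {(a, b, c). distinct (a @ b @ c) \<and> set (a @ b @ c) = S}"
  \<comment> \<open>The pair joining \<open>a\<close> to \<open>b @ [v]\<close> has no factor in
    \<open>F\<close> because it is the place where 1 was chosen.\<close>
  define F where "F = (\<lambda>(a, b, c). path_weight s a * path_weight t (b @ [v]) * path_weight s (v # c))"
  define Y where "Y = {(a, c). distinct (a @ c) \<and> set (a @ c) = S}"
  have finX: "finite X" unfolding X_def by (rule finite_list_triples[OF assms(1)])
  have "Y \<subseteq> (\<lambda>(a, b, c). (a, c)) ` X"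
  proof
    fix p assume "p \<in> Y"
    then have "(fst p, [], snd p) \<in> X" by (auto simp: X_def Y_def)
    then show "p \<in> (\<lambda>(a, b, c). (a, c)) ` X" by force
  qed
  then have finY: "finite Y" using finX by (meson finite_imageI finite_subset)
  have "path_sum t (insert v S) = (\<Sum>(a, c)\<in>Y. path_weight s (a @ v # c))"
    unfolding path_sum_def s_def
  proof (rule sum.reindex_bij_witness[where i = "\<lambda>(a, c). a @ v # c" and
        j = "\<lambda>w. (takeWhile (\<lambda>x. x \<noteq> v) w, tl (dropWhile (\<lambda>x. x \<noteq> v) w))"])
    fix w assume "w \<in> permutations_of_set (insert v S)"
    then have w: "set w = insert v S" "distinct w" by (auto dest: permutations_of_setD)
    then obtain a c where "w = a @ v # c" by (metis insertI1 split_list)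
    with w assms(2) show "(case (takeWhile (\<lambda>x. x \<noteq> v) w, tl (dropWhile (\<lambda>x. x \<noteq> v) w)) of (a, c) \<Rightarrow> a @ v # c) = w"
      "(takeWhile (\<lambda>x. x \<noteq> v) w, tl (dropWhile (\<lambda>x. x \<noteq> v) w)) \<in> Y"
      "(case (takeWhile (\<lambda>x. x \<noteq> v) w, tl (dropWhile (\<lambda>x. x \<noteq> v) w)) of (a, c) \<Rightarrow> path_weight (\<lambda>a. t a + 1) (a @ v # c)) =
         path_weight (\<lambda>a. t a + 1) w"
      by (auto simp: takeWhile_append_notin dropWhile_append_notin Y_def)
  next
    fix p assume "p \<in> Y"
    with assms(2) show "(takeWhile (\<lambda>x. x \<noteq> v) (case p of (a, c) \<Rightarrow> a @ v # c), tl (dropWhile (\<lambda>x. x \<noteq> v) (case p of (a, c) \<Rightarrow> a @ v # c))) = p"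
      "(case p of (a, c) \<Rightarrow> a @ v # c) \<in> permutations_of_set (insert v S)"
      by (auto simp: takeWhile_append_notin dropWhile_append_notin Y_def)
  qed
  also have "\<dots> = (\<Sum>p\<in>Y. \<Sum>j\<le>length (fst p). F (take j (fst p), drop j (fst p), snd p))"
  proof (intro sum.cong refl)
    fix p assume "p \<in> Y"
    have "path_weight s (fst p @ v # snd p) = path_weight s (fst p @ [v]) * path_weight s (v # snd p)"
      by (rule path_weight_split)
    then show "(case p of (a, c) \<Rightarrow> path_weight s (a @ v # c)) =
        (\<Sum>j\<le>length (fst p). F (take j (fst p), drop j (fst p), snd p))"
      by (simp add: split_def path_weight_telescope s_def F_def sum_distrib_right)
  qed
  also have "\<dots> = (\<Sum>(p, j)\<in>(SIGMA p:Y. {..length (fst p)}). F (take j (fst p), drop j (fst p), snd p))"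
    using finY by (simp add: sum.Sigma)
  \<comment> \<open>The part before \<open>v\<close> is cut after \<open>j\<close> entries; the
    length of the first component of the triple recovers \<open>j\<close>.\<close>
  also have "\<dots> = (\<Sum>q\<in>X. F q)"
  proof (rule sum.reindex_bij_witness[where i = "\<lambda>(a, b, c). ((a @ b, c), length a)" and
        j = "\<lambda>((a, c), j). (take j a, drop j a, c)"])
    fix p assume "p \<in> (SIGMA p:Y. {..length (fst p)})"
    then obtain a c j where p: "p = ((a, c), j)" "j \<le> length a" "distinct (a @ c)" "set (a @ c) = S"
      by (auto simp: Y_def)
    have "take j a @ drop j a @ c = a @ c" by (metis append.assoc append_take_drop_id)
    then have "distinct (take j a @ drop j a @ c)" "set (take j a @ drop j a @ c) = S"
      using p(3,4) by metis+
    then show "(case p of (x, xa) \<Rightarrow> (case x of (a, c) \<Rightarrow> \<lambda>j. (take j a, drop j a, c)) xa) \<in> X"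
      using p(1) by (simp add: X_def)
  qed (auto simp: X_def Y_def)
  finally have 1: "path_sum t (insert v S) = (\<Sum>q\<in>X. F q)" .
  define D where "D = {u. distinct u \<and> set u \<subseteq> S}"
  have finD: "finite D" unfolding D_def by (rule finite_distinct_lists_subset[OF assms(1)])
  \<comment> \<open>In the telescoped cycle weight, \<open>take j u\<close> is reached from
    \<open>v\<close> by factors \<open>t + 1\<close> and \<open>drop j u\<close> returns to
    \<open>v\<close> by factors \<open>t\<close>. They play the roles of \<open>c\<close> and
    \<open>b\<close>, and a listing of \<open>S - set u\<close> plays that of
    \<open>a\<close>.\<close>
  have "(\<Sum>u\<in>D. cycle_weight t (v # u) * path_sum t (S - set u)) =
    (\<Sum>u\<in>D. \<Sum>(j, a)\<in>{..length u} \<times> permutations_of_set (S - set u). F (a, drop j u, take j u))"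
    unfolding cycle_weight_Cons path_sum_def sum_product sum.cartesian_product
    by (intro sum.cong refl) (auto simp: F_def s_def mult_ac)
  also have "\<dots> = (\<Sum>(u, j, a)\<in>(SIGMA u:D. {..length u} \<times> permutations_of_set (S - set u)). F (a, drop j u, take j u))"
    using finD by (subst sum.Sigma) auto
  also have "\<dots> = (\<Sum>q\<in>X. F q)"
  proof (rule sum.reindex_bij_witness[where i = "\<lambda>(a, b, c). (c @ b, length c, a)" and
          j = "\<lambda>(u, j, a). (a, drop j u, take j u)"])
    fix p assume "p \<in> (SIGMA u:D. {..length u} \<times> permutations_of_set (S - set u))"
    then obtain u j a where p: "p = (u, j, a)" "j \<le> length u" "distinct u" "set u \<subseteq> S"
      "distinct a" "set a = S - set u" by (auto simp: D_def permutations_of_set_def)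
    have "set (take j u) \<union> set (drop j u) = set u" "set (take j u) \<inter> set (drop j u) = {}"
      using p by (metis append_take_drop_id set_append, simp add: set_take_disj_set_drop_if_distinct)
    then show "(case p of (u, j, a) \<Rightarrow> (a, drop j u, take j u)) \<in> X"
      using p by (auto simp: X_def)
  qed (auto simp: X_def D_def permutations_of_set_def)
  finally show ?thesis using 1 by (simp add: D_def)
qed


section \<open>Permutations\<close>

lemma rotation_class_rotate: "rotation_class (rotate j l) = rotation_class l"
proof -
  have sub: "rotation_class (rotate j l) \<subseteq> rotation_class l" for j and l :: "'a list"
    by (auto simp: rotation_class_def rotate_rotate)
  obtain k where "rotate k (rotate j l) = l"
  proof (cases "l = []")
    case False
    \<comment> \<open>A further rotation by the complement of \<open>j\<close> modulo the length
      undoes the rotation by \<open>j\<close>.\<close>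
    have "(length l - j mod length l + j) mod length l = 0"
      using False by (metis add.commute add_diff_inverse_nat less_imp_not_less length_greater_0_conv mod_add_left_eq mod_less_divisor mod_self)
    then show ?thesis
      by (intro that[of "length l - j mod length l"]) (simp add: rotate_rotate rotate_conv_mod[of "_ + _"])
  qed (auto intro: that)
  then show ?thesis using sub[of j l] sub[of k "rotate j l"] by auto
qed

text \<open>The map equation says that \<open>\<sigma>\<close> sends each entry to its cyclic
  successor, so the iterates of \<open>hd l\<close> run through \<open>l\<close> cyclically. By
  distinctness the first return to \<open>hd l\<close> happens after \<open>length l\<close>
  steps.\<close>

lemma support_eqI:
  assumes "distinct l" "l \<noteq> []" "map \<sigma> l = rotate1 l"
  shows "support \<sigma> (hd l) = l"
proof -
  have step: "\<sigma> (l ! k) = l ! (Suc k mod length l)" if "k < length l" for k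
    using that assms(3) by (metis nth_map nth_rotate1)
  have pow: "(\<sigma> ^^ k) (hd l) = l ! (k mod length l)" for k
  proof (induction k)
    case (Suc k)
    then show ?case using assms(2) by (simp add: step mod_Suc_eq)
  qed (use assms(2) in \<open>simp add: hd_conv_nth\<close>)
  have "least_power \<sigma> (hd l) = length l"
    unfolding least_power_def
  proof (rule Least_equality)
    show "(\<sigma> ^^ length l) (hd l) = hd l \<and> 0 < length l"
      using assms(2) pow[of "length l"] by (simp add: hd_conv_nth)
    show "length l \<le> n" if "(\<sigma> ^^ n) (hd l) = hd l \<and> 0 < n" for n
    proof (rule ccontr)
      assume "\<not> length l \<le> n"
      with that pow[of n] show False using assms(1,2) by (simp add: hd_conv_nth nth_eq_iff_index_eq)
    qed
  qed
  then show ?thesis by (intro nth_equalityI) (simp_all add: pow)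
qed

lemma map_support:
  assumes "permutation \<sigma>"
  shows "map \<sigma> (support \<sigma> x) = rotate1 (support \<sigma> x)"
proof -
  have "map \<sigma> (support \<sigma> x) = map (cycle_of_list (support \<sigma> x)) (support \<sigma> x)"
    by (rule map_cong[OF refl cycle_restrict[OF assms]])
  also have "\<dots> = rotate1 (support \<sigma> x)"
    using cyclic_rotation[OF cycle_of_permutation[OF assms, of x], of 1] by simp
  finally show ?thesis .
qed

lemma support_nonempty: "permutation \<sigma> \<Longrightarrow> support \<sigma> x \<noteq> []"
  by (simp add: least_power_of_permutation(2))

lemma hd_support: "permutation \<sigma> \<Longrightarrow> hd (support \<sigma> x) = x"
  by (simp add: hd_map least_power_of_permutation(2))

lemma self_in_support: "permutation \<sigma> \<Longrightarrow> x \<in> set (support \<sigma> x)"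
  by (metis hd_in_set hd_support support_nonempty)

text \<open>Rotating the support of \<open>x\<close> until it begins with \<open>y\<close> yields a
  list that \<open>\<sigma>\<close> still shifts cyclically, and \<open>support_eqI\<close>
  identifies this list with the support of \<open>y\<close>.\<close>

lemma rotation_class_support_eq_iff:
  assumes "permutation \<sigma>"
  shows "rotation_class (support \<sigma> x) = rotation_class (support \<sigma> y) \<longleftrightarrow> y \<in> set (support \<sigma> x)"
proof
  assume "rotation_class (support \<sigma> x) = rotation_class (support \<sigma> y)"
  moreover have "rotate 0 (support \<sigma> y) \<in> rotation_class (support \<sigma> y)"
    unfolding rotation_class_def by blast
  ultimately obtain j where "support \<sigma> y = rotate j (support \<sigma> x)"
    unfolding rotation_class_def by auto
  then show "y \<in> set (support \<sigma> x)"
    using self_in_support[OF assms, of y] by (metis set_rotate)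
next
  define l where "l = support \<sigma> x"
  assume "y \<in> set (support \<sigma> x)"
  then obtain j where j: "j < length l" "y = l ! j" unfolding l_def by (metis in_set_conv_nth)
  have l: "distinct l" "l \<noteq> []" "map \<sigma> l = rotate1 l"
    unfolding l_def
    by (rule cycle_of_permutation[OF assms] support_nonempty[OF assms] map_support[OF assms])+
  have "support \<sigma> (hd (rotate j l)) = rotate j l"
    using l by (intro support_eqI) (simp_all add: rotate_map[symmetric] rotate1_rotate_swap)
  then have "support \<sigma> y = rotate j l"
    using j l(2) by (simp add: hd_rotate_conv_nth)
  then show "rotation_class (support \<sigma> x) = rotation_class (support \<sigma> y)"
    by (simp add: l_def rotation_class_rotate)
qed

lemma cycles_conv_image: "cycles V \<sigma> = (\<lambda>x. rotation_class (support \<sigma> x)) ` V"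
  by (auto simp: cycles_def)

lemma prod_CArcs_diff:
  assumes "distinct l" "l \<noteq> []"
  shows "(\<Prod>a\<in>CArcs (rotation_class l). t a + 1) - (\<Prod>a\<in>CArcs (rotation_class l). t a) =
    cycle_weight t l"
  using assms by (simp add: CArcs_rotation_class prod_list_CArcs cycle_weight_def)

lemma set_support_subset:
  assumes "\<sigma> permutes S" "x \<in> S"
  shows "set (support \<sigma> x) \<subseteq> S"
  using permutes_in_image[OF permutes_funpow[OF assms(1)]] assms(2) by auto

section \<open>Splitting off one cycle\<close>

lemma cycle_comp_permutes:
  assumes "\<tau> permutes S - set l" "set l \<subseteq> S"
  shows "cycle_of_list l \<circ> \<tau> permutes S"
  using permutes_compose[OF permutes_subset[OF assms(1), of S] permutes_subset[OF cycle_permutes assms(2)]]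
  by simp

text \<open>On the entries of \<open>l\<close> the permutation \<open>\<tau>\<close> is the
  identity, so there the composition acts as the cycle alone.\<close>

lemma support_cycle_comp:
  assumes "\<tau> permutes S - set l" "distinct l" "l \<noteq> []"
  shows "support (cycle_of_list l \<circ> \<tau>) (hd l) = l"
proof (rule support_eqI)
  have "map (cycle_of_list l \<circ> \<tau>) l = map (cycle_of_list l) l"
    using assms(1) by (intro map_cong refl) (simp add: permutes_not_in)
  also have "\<dots> = rotate1 l"
    using cyclic_rotation[OF assms(2), of 1] by simp
  finally show "map (cycle_of_list l \<circ> \<tau>) l = rotate1 l" .
qed (use assms in auto)

text \<open>The orbit of \<open>x\<close> under \<open>\<tau>\<close> never leaves
  \<open>S - set l\<close>, where the cycle acts as the identity.\<close>

lemma support_cycle_comp_outside: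
  assumes "\<tau> permutes S - set l" "x \<in> S - set l"
  shows "support (cycle_of_list l \<circ> \<tau>) x = support \<tau> x"
proof -
  have "((cycle_of_list l \<circ> \<tau>) ^^ k) x = (\<tau> ^^ k) x" for k
  proof (induction k)
    case (Suc k)
    have "(\<tau> ^^ Suc k) x \<in> S - set l"
      using permutes_in_image[OF permutes_funpow[OF assms(1), of "Suc k"]] assms(2) by blast
    then show ?case using Suc by (simp add: id_outside_supp)
  qed simp
  then show ?thesis by (simp add: least_power_def)
qed

section \<open>The recursion for sums over permutations\<close>

definition cycle_sum :: "('v \<times> 'v \<Rightarrow> 'k::{comm_ring, comm_monoid_mult}) \<Rightarrow> 'v set \<Rightarrow> 'k" where
  "cycle_sum t S = (\<Sum>\<sigma> | \<sigma> permutes S.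
     \<Prod>\<gamma>\<in>cycles S \<sigma>. (\<Prod>a\<in>CArcs \<gamma>. t a + 1) - (\<Prod>a\<in>CArcs \<gamma>. t a))"

text \<open>Permutations of \<open>insert v S\<close> correspond to pairs of a list \<open>u\<close>
  and a permutation \<open>\<tau>\<close> of \<open>S - set u\<close>. Writing the cycle through
  \<open>v\<close> with \<open>v\<close> in front makes \<open>u\<close> unique.\<close>

lemma cycle_sum_insert:
  assumes "finite S" "v \<notin> S"
  shows "cycle_sum t (insert v S) =
    (\<Sum>u | distinct u \<and> set u \<subseteq> S. cycle_weight t (v # u) * cycle_sum t (S - set u))"
proof -
  define D where "D = {u. distinct u \<and> set u \<subseteq> S}"
  define w where "w = (\<lambda>\<gamma>. (\<Prod>a\<in>CArcs \<gamma>. t a + 1) - (\<Prod>a\<in>CArcs \<gamma>. t a))"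
  have finD: "finite D" unfolding D_def by (rule finite_distinct_lists_subset[OF assms(1)])
  have diff: "insert v S - set (v # u) = S - set u" for u using assms(2) by auto
  have *: "cycle_of_list (v # u) \<circ> \<tau> permutes insert v S"
      "support (cycle_of_list (v # u) \<circ> \<tau>) v = v # u"
      "x \<in> S - set u \<Longrightarrow> support (cycle_of_list (v # u) \<circ> \<tau>) x = support \<tau> x"
    if "u \<in> D" "\<tau> permutes S - set u" for u \<tau> x
    using that assms(2) cycle_comp_permutes[of \<tau> "insert v S" "v # u"]
      support_cycle_comp[of \<tau> "insert v S" "v # u"] support_cycle_comp_outside[of \<tau> "insert v S" "v # u" x]
    unfolding diff by (auto simp: D_def simp del: cycle_of_list.simps)
  \<comment> \<open>The cycles of the composition are those of \<open>\<tau>\<close> together with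
    the class of \<open>v # u\<close>. This class is new because its support meets no point of
    \<open>S - set u\<close>, so the product over the set of cycles gains exactly one
    factor.\<close>
  have prods: "(\<Prod>\<gamma>\<in>cycles (insert v S) (cycle_of_list (v # u) \<circ> \<tau>). w \<gamma>) =
      cycle_weight t (v # u) * (\<Prod>\<gamma>\<in>cycles (S - set u) \<tau>. w \<gamma>)"
    if "u \<in> D" "\<tau> permutes S - set u" for u \<tau>
  proof -
    define \<sigma> where "\<sigma> = cycle_of_list (v # u) \<circ> \<tau>"
    note \<sigma> = *[OF that, folded \<sigma>_def]
    have perm: "permutation \<sigma>"
      using \<sigma>(1) assms(1) unfolding permutation_permutes by (metis finite_insert)
    have u: "distinct (v # u)" "set u \<subseteq> S" using that(1) assms(2) by (auto simp: D_def)
    have cyc: "cycles (S - set u) \<tau> = (\<lambda>x. rotation_class (support \<sigma> x)) ` (S - set u)"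
      unfolding cycles_conv_image using \<sigma>(3) by (intro image_cong) auto
    have in_u: "rotation_class (support \<sigma> x) = rotation_class (v # u)" if "x \<in> set (v # u)" for x
      using that rotation_class_support_eq_iff[OF perm, of v x] \<sigma>(2) by simp
    have eq: "insert v S = set (v # u) \<union> (S - set u)" using u by auto
    have "(\<lambda>x. rotation_class (support \<sigma> x)) ` set (v # u) = {rotation_class (v # u)}"
      using in_u by force
    then have "cycles (insert v S) \<sigma> = insert (rotation_class (v # u)) (cycles (S - set u) \<tau>)"
      by (simp only: cyc cycles_conv_image[of _ \<sigma>] eq image_Un Un_insert_left Un_empty_left)
    moreover have "rotation_class (v # u) \<notin> cycles (S - set u) \<tau>"
    proof
      assume "rotation_class (v # u) \<in> cycles (S - set u) \<tau>"
      then obtain x where x: "x \<in> S - set u" "rotation_class (support \<sigma> v) = rotation_class (support \<sigma> x)"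
        unfolding cyc \<sigma>(2) by auto
      then have "x \<in> set (v # u)" using rotation_class_support_eq_iff[OF perm, of v x] \<sigma>(2) by simp
      with x(1) assms(2) show False by auto
    qed
    moreover have "finite (cycles (S - set u) \<tau>)" unfolding cyc using assms(1) by simp
    moreover have "w (rotation_class (v # u)) = cycle_weight t (v # u)"
      unfolding w_def using u by (intro prod_CArcs_diff) auto
    ultimately show ?thesis by (simp add: \<sigma>_def)
  qed
  have "cycle_sum t (insert v S) =
      (\<Sum>(u, \<tau>)\<in>(SIGMA u:D. {\<tau>. \<tau> permutes S - set u}).
        cycle_weight t (v # u) * (\<Prod>\<gamma>\<in>cycles (S - set u) \<tau>. w \<gamma>))"
    unfolding cycle_sum_def w_def[symmetric]
  \<comment> \<open>The inverse map reads off \<open>u\<close> as the tail of the support of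
    \<open>v\<close> and obtains \<open>\<tau>\<close> by turning all points of that support into
    fixed points.\<close>
  proof (rule sum.reindex_bij_witness[symmetric, where
        i = "\<lambda>\<sigma>. (tl (support \<sigma> v), \<lambda>y. if y \<in> insert v S - set (support \<sigma> v) then \<sigma> y else y)" and
        j = "\<lambda>(u, \<tau>). cycle_of_list (v # u) \<circ> \<tau>"])
    fix p assume "p \<in> (SIGMA u:D. {\<tau>. \<tau> permutes S - set u})"
    then obtain u \<tau> where p: "p = (u, \<tau>)" "u \<in> D" "\<tau> permutes S - set u" by auto
    define \<sigma> where "\<sigma> = cycle_of_list (v # u) \<circ> \<tau>"
    note \<sigma> = *[OF p(2,3), folded \<sigma>_def]
    have "(if y \<in> insert v S - set (v # u) then \<sigma> y else y) = \<tau> y" for y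
    proof (cases "y \<in> S - set u")
      case True
      then have "\<tau> y \<in> S - set u" using permutes_in_image[OF p(3)] by blast
      then have "\<tau> y \<notin> set (v # u)" using assms(2) by auto
      then show ?thesis using True assms(2) by (auto simp: \<sigma>_def id_outside_supp)
    next
      case False
      then show ?thesis using permutes_not_in[OF p(3) False] by auto
    qed
    then show "(tl (support (case p of (u, \<tau>) \<Rightarrow> cycle_of_list (v # u) \<circ> \<tau>) v),
          \<lambda>y. if y \<in> insert v S - set (support (case p of (u, \<tau>) \<Rightarrow> cycle_of_list (v # u) \<circ> \<tau>) v)
            then (case p of (u, \<tau>) \<Rightarrow> cycle_of_list (v # u) \<circ> \<tau>) y else y) = p"
      unfolding p(1) prod.case \<sigma>_def[symmetric] \<sigma>(2) by auto
    show "(case p of (u, \<tau>) \<Rightarrow> cycle_of_list (v # u) \<circ> \<tau>) \<in> {\<sigma>. \<sigma> permutes insert v S}"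
      using \<sigma>(1) by (simp add: p(1) \<sigma>_def)
    show "prod w (cycles (insert v S) (case p of (u, \<tau>) \<Rightarrow> cycle_of_list (v # u) \<circ> \<tau>)) =
        (case p of (u, \<tau>) \<Rightarrow> cycle_weight t (v # u) * prod w (cycles (S - set u) \<tau>))"
      unfolding p(1) prod.case by (rule prods[OF p(2,3)])
  next
    fix \<sigma> assume "\<sigma> \<in> {\<sigma>. \<sigma> permutes insert v S}"
    then have \<sigma>: "\<sigma> permutes insert v S" by simp
    then have perm: "permutation \<sigma>"
      using assms(1) unfolding permutation_permutes by (metis finite_insert)
    define u where "u = tl (support \<sigma> v)"
    define \<tau> where "\<tau> = (\<lambda>y. if y \<in> insert v S - set (support \<sigma> v) then \<sigma> y else y)"
    have supp: "support \<sigma> v = v # u"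
      unfolding u_def by (metis hd_support[OF perm] list.collapse support_nonempty[OF perm])
    have dist: "distinct (v # u)" using cycle_of_permutation[OF perm, of v] unfolding supp .
    have sub: "set (v # u) \<subseteq> insert v S" using set_support_subset[OF \<sigma>, of v] unfolding supp by simp
    have \<tau>: "\<tau> permutes S - set u"
      using semidecomposition[OF \<sigma>, of v] assms(1) unfolding \<tau>_def supp diff by simp
    \<comment> \<open>Three regions are compared: the cycle through \<open>v\<close>, the rest of
      \<open>insert v S\<close>, and the outside, where both sides fix \<open>y\<close>.\<close>
    have "cycle_of_list (v # u) (\<tau> y) = \<sigma> y" for y
    proof (cases "y \<in> set (v # u)")
      case True
      then show ?thesis using cycle_restrict[OF perm, of y v] by (simp only: supp \<tau>_def) simp
    next
      case False
      show ?thesis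
      proof (cases "y \<in> insert v S")
        case True
        with False have "y \<in> S - set u" by auto
        then have "\<tau> y \<in> S - set u" using permutes_in_image[OF \<tau>] by blast
        then have "\<tau> y \<notin> set (v # u)" using assms(2) by auto
        moreover have "\<tau> y = \<sigma> y" using True False by (simp add: \<tau>_def supp)
        ultimately show ?thesis by (metis id_outside_supp)
      next
        case no: False
        then have "\<tau> y = y" by (simp add: \<tau>_def)
        then show ?thesis using False permutes_not_in[OF \<sigma> no] by (metis id_outside_supp)
      qed
    qed
    then have "cycle_of_list (v # u) \<circ> \<tau> = \<sigma>" by (simp add: fun_eq_iff del: cycle_of_list.simps)
    then show "(case (tl (support \<sigma> v), \<lambda>y. if y \<in> insert v S - set (support \<sigma> v) then \<sigma> y else y) of
         (u, \<tau>) \<Rightarrow> cycle_of_list (v # u) \<circ> \<tau>) = \<sigma>"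
      unfolding \<tau>_def[symmetric] u_def[symmetric] by simp
    show "(tl (support \<sigma> v), \<lambda>y. if y \<in> insert v S - set (support \<sigma> v) then \<sigma> y else y)
        \<in> (SIGMA u:D. {\<tau>. \<tau> permutes S - set u})"
      unfolding \<tau>_def[symmetric] u_def[symmetric] using \<tau> dist sub by (auto simp: D_def)
  qed
  also have "\<dots> = (\<Sum>u\<in>D. cycle_weight t (v # u) * cycle_sum t (S - set u))"
    using finD assms(1)
    by (subst sum.Sigma[symmetric])
      (auto simp: finite_permutations cycle_sum_def w_def sum_distrib_left)
  finally show ?thesis by (simp add: D_def)
qed

text \<open>Both sums are 1 for the empty set and satisfy the same recursion. The induction runs
  over proper subsets because the recursion refers to all sets \<open>S' - set u\<close>, none of
  which contains \<open>v\<close>.\<close>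

lemma path_sum_eq_cycle_sum: "finite S \<Longrightarrow> path_sum t S = cycle_sum t S"
proof (induction S rule: finite_psubset_induct)
  case (psubset S)
  show ?case
  proof (cases "S = {}")
    case True
    then show ?thesis by (simp add: path_sum_def cycle_sum_def cycles_def)
  next
    case False
    then obtain v S' where S: "S = insert v S'" "v \<notin> S'" by (meson ex_in_conv mk_disjoint_insert)
    have "path_sum t (S' - set u) = cycle_sum t (S' - set u)" for u
      using S by (intro psubset.IH) auto
    then show ?thesis
      using S psubset.hyps by (simp add: path_sum_insert cycle_sum_insert)
  qed
qed


section \<open>Coloured weights\<close>

lemma prod_eq_0I:
  fixes f :: "'a \<Rightarrow> 'k::{comm_ring, comm_monoid_mult}"
  assumes "finite A" "a \<in> A" "f a = 0"
  shows "prod f A = 0"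
  using assms by (simp add: prod.remove)

text \<open>
  With these weights a colour descent annihilates the product of the \<open>t + 1\<close> and a colour ascent
  annihilates the product of the \<open>t\<close>, so only sorted listings and monochromatic cycles survive.
\<close>

definition coloured_weight ::
  "('v \<Rightarrow> nat) \<Rightarrow> ('v \<times> 'v \<Rightarrow> 'k) \<Rightarrow> 'v \<times> 'v \<Rightarrow> 'k::{comm_ring, comm_monoid_mult}" where
  "coloured_weight f t = (\<lambda>(x, y). if f x = f y then t (x, y) else if f x < f y then 0 else - 1)"

lemma path_weight_cong:
  "(\<And>x y. x \<in> set l \<Longrightarrow> y \<in> set l \<Longrightarrow> f (x, y) = g (x, y)) \<Longrightarrow> path_weight f l = path_weight g l"
  unfolding path_weight_conv_prod by (intro prod.cong) auto

text \<open>An ascent has factor \<open>0 + 1\<close> and a descent \<open>- 1 + 1\<close>. The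
  product that survives is the coefficient of \<open>w\<close> in the deformed series for the index
  list \<open>map f w\<close>.\<close>

lemma path_weight_coloured_plus_1:
  "path_weight (\<lambda>a. coloured_weight f t a + 1) w =
    (if sorted (map f w)
     then \<Prod>k | Suc k < length w \<and> f (w ! k) = f (w ! Suc k). t (w ! k, w ! Suc k) + 1 else 0)"
proof (cases "sorted (map f w)")
  case True
  have "(\<Prod>k<length w - 1. coloured_weight f t (w ! k, w ! Suc k) + 1) =
      (\<Prod>k<length w - 1. if f (w ! k) = f (w ! Suc k) then t (w ! k, w ! Suc k) + 1 else 1)"
  proof (intro prod.cong refl)
    fix k assume "k \<in> {..<length w - 1}"
    then have "f (w ! k) \<le> f (w ! Suc k)"
      using True by (auto simp: sorted_iff_nth_Suc)
    then show "coloured_weight f t (w ! k, w ! Suc k) + 1 =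
        (if f (w ! k) = f (w ! Suc k) then t (w ! k, w ! Suc k) + 1 else 1)"
      by (simp add: coloured_weight_def)
  qed
  also have "\<dots> = (\<Prod>k\<in>{k \<in> {..<length w - 1}. f (w ! k) = f (w ! Suc k)}. t (w ! k, w ! Suc k) + 1)"
    by (rule prod.inter_filter[symmetric]) simp
  also have "{k \<in> {..<length w - 1}. f (w ! k) = f (w ! Suc k)} =
      {k. Suc k < length w \<and> f (w ! k) = f (w ! Suc k)}" by auto
  finally show ?thesis using True by (simp add: path_weight_conv_prod)
next
  case False
  then obtain k where "Suc k < length w" "f (w ! k) > f (w ! Suc k)"
    by (auto simp: sorted_iff_nth_Suc not_le)
  then have "(\<Prod>k<length w - 1. coloured_weight f t (w ! k, w ! Suc k) + 1) = 0"
    by (intro prod_eq_0I[of _ k]) (auto simp: coloured_weight_def)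
  then show ?thesis using False by (simp add: path_weight_conv_prod)
qed

lemma path_weight_coloured_eq_0:
  assumes "\<not> sorted_wrt (\<ge>) (map f w)"
  shows "path_weight (coloured_weight f t) w = 0"
proof -
  have "transp ((\<ge>) :: nat \<Rightarrow> nat \<Rightarrow> bool)" by (auto simp: transp_def)
  then obtain k where "Suc k < length w" "f (w ! k) < f (w ! Suc k)"
    using assms by (auto simp: sorted_wrt_iff_nth_Suc_transp not_le)
  then have "(\<Prod>k<length w - 1. coloured_weight f t (w ! k, w ! Suc k)) = 0"
    by (intro prod_eq_0I[of _ k]) (auto simp: coloured_weight_def)
  then show ?thesis by (simp add: path_weight_conv_prod)
qed

text \<open>The colours along the closed path begin and end with the same value. If they are not
  constant, they can be neither weakly increasing nor weakly decreasing, so both products in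
  \<open>cycle_weight\<close> vanish.\<close>

lemma cycle_weight_coloured:
  assumes "l \<noteq> []"
  shows "cycle_weight (coloured_weight f t) l =
    (if \<forall>x\<in>set l. f x = f (hd l) then cycle_weight t l else 0)"
proof (cases "\<forall>x\<in>set l. f x = f (hd l)")
  case True
  then have "coloured_weight f t (x, y) = t (x, y)"
    if "x \<in> set (l @ [hd l])" "y \<in> set (l @ [hd l])" for x y
    using that by (auto simp: coloured_weight_def)
  then have "path_weight (coloured_weight f t) (l @ [hd l]) = path_weight t (l @ [hd l])"
    "path_weight (\<lambda>a. coloured_weight f t a + 1) (l @ [hd l]) = path_weight (\<lambda>a. t a + 1) (l @ [hd l])"
    by (metis (no_types, lifting) path_weight_cong)+
  with True show ?thesis by (simp add: cycle_weight_def)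
next
  case False
  obtain h u where l: "l = h # u" using assms by (cases l) auto
  have "\<not> sorted (map f (l @ [hd l]))" "\<not> sorted_wrt (\<ge>) (map f (l @ [hd l]))"
    using False unfolding l by (auto simp: sorted_append sorted_wrt_append intro: antisym)
  then have "path_weight (\<lambda>a. coloured_weight f t a + 1) (l @ [hd l]) = 0"
    "path_weight (coloured_weight f t) (l @ [hd l]) = 0"
    by (metis path_weight_coloured_plus_1, metis path_weight_coloured_eq_0)
  then show ?thesis unfolding if_not_P[OF False] by (simp add: cycle_weight_def)
qed

text \<open>One cycle with two colours annihilates the product of its permutation. Constancy on
  cycles is phrased by rotation classes to match the condition in
  \<open>mfps_coeff_power_sum_cycle_type\<close>.\<close>

lemma cycle_sum_coloured:
  fixes V :: "'v set" and t :: "'v \<times> 'v \<Rightarrow> 'k::{comm_ring, comm_monoid_mult}"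
  assumes "finite V"
  shows "cycle_sum (coloured_weight f t) V =
    (\<Sum>\<sigma> | \<sigma> permutes V.
       if \<forall>x\<in>V. \<forall>y\<in>V. rotation_class (support \<sigma> x) = rotation_class (support \<sigma> y) \<longrightarrow> f x = f y
       then \<Prod>\<gamma>\<in>cycles V \<sigma>. (\<Prod>a\<in>CArcs \<gamma>. t a + 1) - (\<Prod>a\<in>CArcs \<gamma>. t a) else 0)"
  unfolding cycle_sum_def
proof (intro sum.cong refl)
  fix \<sigma> assume "\<sigma> \<in> {\<sigma>. \<sigma> permutes V}"
  then have \<sigma>: "\<sigma> permutes V" by simp
  then have perm: "permutation \<sigma>" using assms unfolding permutation_permutes by blast
  define cls where "cls = (\<lambda>x. rotation_class (support \<sigma> x))"
  define w where "w = (\<lambda>(t :: 'v \<times> 'v \<Rightarrow> 'k) \<gamma>. (\<Prod>a\<in>CArcs \<gamma>. t a + 1) - (\<Prod>a\<in>CArcs \<gamma>. t a))"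
  have w: "w t (cls x) = cycle_weight t (support \<sigma> x)" for t x
    unfolding w_def cls_def
    by (rule prod_CArcs_diff[OF cycle_of_permutation[OF perm] support_nonempty[OF perm]])
  have *: "w (coloured_weight f t) (cls x) = (if \<forall>y\<in>set (support \<sigma> x). f y = f x then w t (cls x) else 0)"
    for x
    unfolding w cycle_weight_coloured[OF support_nonempty[OF perm]] hd_support[OF perm] ..
  have cls: "cls x = cls y \<longleftrightarrow> y \<in> set (support \<sigma> x)" for x y
    unfolding cls_def by (rule rotation_class_support_eq_iff[OF perm])
  have cycles: "cycles V \<sigma> = cls ` V" unfolding cls_def by (rule cycles_conv_image)
  show "(\<Prod>\<gamma>\<in>cycles V \<sigma>. (\<Prod>a\<in>CArcs \<gamma>. coloured_weight f t a + 1) - (\<Prod>a\<in>CArcs \<gamma>. coloured_weight f t a)) =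
    (if \<forall>x\<in>V. \<forall>y\<in>V. rotation_class (support \<sigma> x) = rotation_class (support \<sigma> y) \<longrightarrow> f x = f y
       then \<Prod>\<gamma>\<in>cycles V \<sigma>. (\<Prod>a\<in>CArcs \<gamma>. t a + 1) - (\<Prod>a\<in>CArcs \<gamma>. t a) else 0)"
    unfolding fun_cong[OF fun_cong[OF w_def], symmetric] fun_cong[OF cls_def, symmetric] cycles
  proof (cases "\<forall>x\<in>V. \<forall>y\<in>V. cls x = cls y \<longrightarrow> f x = f y")
    case True
    have "f y = f x" if "x \<in> V" "y \<in> set (support \<sigma> x)" for x y
      using True that set_support_subset[OF \<sigma> that(1)] cls[of x y] by (metis subsetD)
    then have "prod (w (coloured_weight f t)) (cls ` V) = prod (w t) (cls ` V)"
      by (intro prod.cong refl) (auto simp: *)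
    then show "prod (w (coloured_weight f t)) (cls ` V) =
        (if \<forall>x\<in>V. \<forall>y\<in>V. cls x = cls y \<longrightarrow> f x = f y then prod (w t) (cls ` V) else 0)"
      unfolding if_P[OF True] .
  next
    case False
    then obtain x y where xy: "x \<in> V" "cls x = cls y" "f x \<noteq> f y" by blast
    then have "y \<in> set (support \<sigma> x)" by (simp only: cls)
    with xy have "w (coloured_weight f t) (cls x) = 0" using *[of x] by metis
    then have "prod (w (coloured_weight f t)) (cls ` V) = 0"
      using xy(1) assms by (intro prod_eq_0I) auto
    then show "prod (w (coloured_weight f t)) (cls ` V) =
        (if \<forall>x\<in>V. \<forall>y\<in>V. cls x = cls y \<longrightarrow> f x = f y then prod (w t) (cls ` V) else 0)"
      unfolding if_not_P[OF False] .
  qed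
qed


section \<open>Coefficients\<close>

lemma mfps_coeff_sum: "mfps_coeff (\<Sum>a\<in>A. F a) m = (\<Sum>a\<in>A. mfps_coeff (F a :: 'k::comm_ring mfps) m)"
  by (induction A rule: infinite_finite_induct) (simp_all add: zero_mfps.rep_eq plus_mfps.rep_eq)

lemma mfps_coeff_X_power:
  "mfps_coeff (mfps_X i ^ k) m =
    (if m = replicate_mset k i then 1 else (0 :: 'k::{comm_ring, comm_monoid_mult}))"
proof -
  have "mfps_X i ^ k = (\<Prod>i\<leftarrow>replicate k i. mfps_X i :: 'k mfps)"
    by (induction k) simp_all
  then show ?thesis by (simp only: mfps_coeff_monomial mset_replicate)
qed

text \<open>For \<open>k > 0\<close> only a variable occurring in \<open>m\<close> can contribute,
  so a finite set \<open>N\<close> of variables suffices. Leaving \<open>N\<close> free allows one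
  set to serve all factors of a product.\<close>

lemma mfps_coeff_power_sum:
  assumes "k > 0" "finite N" "0 \<notin> N" "set_mset m - {0} \<subseteq> N"
  shows "mfps_coeff (power_sum k :: 'k::{comm_ring, comm_monoid_mult} mfps) m =
    (\<Sum>i\<in>N. if m = replicate_mset k i then 1 else 0)"
  unfolding power_sum_def mfps_infsum.rep_eq mfps_coeff_X_power
proof (rule sum.mono_neutral_left)
  show "{a \<in> {1..}. (if m = replicate_mset k a then 1 else 0 :: 'k) \<noteq> 0} \<subseteq> N"
    using assms by (auto split: if_splits)
  show "\<forall>i\<in>N - {a \<in> {1..}. (if m = replicate_mset k a then 1 else 0 :: 'k) \<noteq> 0}.
      (if m = replicate_mset k i then 1 else 0 :: 'k) = 0"
    using assms(3) by (auto simp: Suc_le_eq intro: gr0I)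
qed (rule assms)

text \<open>Expanding the product means choosing a variable \<open>g i\<close> from each factor; the
  chosen powers multiply to the monomial on the right.\<close>

lemma mfps_coeff_prod_power_sum:
  assumes "finite I" "\<And>i. i \<in> I \<Longrightarrow> k i > 0" "finite N" "0 \<notin> N" "set_mset m - {0} \<subseteq> N"
  shows "mfps_coeff (\<Prod>i\<in>I. power_sum (k i) :: 'k::{comm_ring, comm_monoid_mult} mfps) m =
    (\<Sum>g\<in>I \<rightarrow>\<^sub>E N. if (\<Sum>i\<in>I. replicate_mset (k i) (g i)) = m then 1 else 0)"
  using assms(1,2,5)
proof (induction I arbitrary: m)
  case empty
  then show ?case by (auto simp: one_mfps.rep_eq)
next
  case (insert j I)
  define W where "W = (\<lambda>g. \<Sum>i\<in>I. replicate_mset (k i) (g i :: nat))"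
  define P where "P = (\<Prod>i\<in>I. power_sum (k i) :: 'k mfps)"
  have P: "mfps_coeff P b = (\<Sum>g\<in>I \<rightarrow>\<^sub>E N. if W g = b then 1 else 0)" if "set_mset b - {0} \<subseteq> N" for b
    unfolding P_def W_def using insert.prems that by (intro insert.IH) auto
  have "mfps_coeff (\<Prod>i\<in>insert j I. power_sum (k i) :: 'k mfps) m =
      (\<Sum>(a, b)\<in>{(a, b). a + b = m}. mfps_coeff (power_sum (k j)) a * mfps_coeff P b)"
    using insert.hyps by (simp add: times_mfps.rep_eq P_def)
  also have "\<dots> = (\<Sum>(a, b)\<in>{(a, b). a + b = m}. \<Sum>(x, g)\<in>N \<times> (I \<rightarrow>\<^sub>E N).
      if (a, b) = (replicate_mset (k j) x, W g) then 1 else 0)"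
  proof (intro sum.cong refl)
    fix p assume "p \<in> {(a, b). a + b = m}"
    then obtain a b where p: "p = (a, b)" "a + b = m" by auto
    with insert.prems(2) have "set_mset a - {0} \<subseteq> N" "set_mset b - {0} \<subseteq> N" by auto
    then have "mfps_coeff (power_sum (k j)) a * mfps_coeff P b =
      (\<Sum>x\<in>N. if a = replicate_mset (k j) x then 1 else 0 :: 'k) * (\<Sum>g\<in>I \<rightarrow>\<^sub>E N. if W g = b then 1 else 0)"
      using insert.prems(1)[of j] assms(3,4) by (simp add: mfps_coeff_power_sum P)
    also have "\<dots> = (\<Sum>(x, g)\<in>N \<times> (I \<rightarrow>\<^sub>E N). if (a, b) = (replicate_mset (k j) x, W g) then 1 else 0)"
      unfolding sum_product sum.cartesian_product by (intro sum.cong) auto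
    finally show "(case p of (a, b) \<Rightarrow> mfps_coeff (power_sum (k j)) a * mfps_coeff P b) =
      (case p of (a, b) \<Rightarrow> \<Sum>(x, g)\<in>N \<times> (I \<rightarrow>\<^sub>E N). if (a, b) = (replicate_mset (k j) x, W g) then 1 else 0)"
      by (simp add: p(1))
  qed
  \<comment> \<open>After the exchange of sums, each choice of variables fits exactly one splitting
    of its own monomial, so the inner sum has at most one nonzero term.\<close>
  also have "\<dots> = (\<Sum>q\<in>N \<times> (I \<rightarrow>\<^sub>E N). \<Sum>p\<in>{(a, b). a + b = m}.
      if p = (replicate_mset (k j) (fst q), W (snd q)) then 1 else 0)"
    unfolding split_def by (subst sum.swap) simp
  also have "\<dots> = (\<Sum>q\<in>N \<times> (I \<rightarrow>\<^sub>E N). if replicate_mset (k j) (fst q) + W (snd q) = m then 1 else 0)"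
    by (intro sum.cong refl, subst sum.delta) (auto simp: finite_mset_antidiagonal)
  also have "\<dots> = (\<Sum>g\<in>insert j I \<rightarrow>\<^sub>E N. if (\<Sum>i\<in>insert j I. replicate_mset (k i) (g i)) = m then 1 else 0)"
  proof -
    have "(\<Sum>i\<in>insert j I. replicate_mset (k i) ((g(j := x)) i)) = replicate_mset (k j) x + W g" for g x
    proof -
      have "(\<Sum>i\<in>I. replicate_mset (k i) ((g(j := x)) i)) = W g"
        unfolding W_def using insert.hyps(2) by (intro sum.cong) auto
      then show ?thesis using insert.hyps by simp
    qed
    then show ?thesis
      unfolding PiE_insert_eq using insert.hyps(2)
      by (subst sum.reindex[OF inj_combinator]) (auto simp: split_def simp del: sum.insert)
  qed
  finally show ?case .
qed

lemma image_mset_mset_set_conv_sum: "finite A \<Longrightarrow> image_mset f (mset_set A) = (\<Sum>x\<in>A. {#f x#})"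
  by (induction A rule: finite_induct) simp_all

text \<open>A colouring constant on the classes is the same as a choice \<open>g\<close> of one
  colour per class, via \<open>f x = g (cls x)\<close>. Since \<open>k\<close> gives the class
  sizes, both have the same content.\<close>

lemma sum_class_colourings:
  fixes cls :: "'v \<Rightarrow> 'c" and N :: "'n set" and c :: "'k::comm_monoid_add"
  assumes "finite V" "finite N" "\<And>\<gamma>. \<gamma> \<in> cls ` V \<Longrightarrow> k \<gamma> = card {x \<in> V. cls x = \<gamma>}"
  shows "(\<Sum>g\<in>cls ` V \<rightarrow>\<^sub>E N. if (\<Sum>\<gamma>\<in>cls ` V. replicate_mset (k \<gamma>) (g \<gamma>)) = m then c else 0) =
    (\<Sum>f\<in>{f \<in> V \<rightarrow>\<^sub>E N. image_mset f (mset_set V) = m}.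
       if \<forall>x\<in>V. \<forall>y\<in>V. cls x = cls y \<longrightarrow> f x = f y then c else 0)"
proof -
  define I where "I = cls ` V"
  \<comment> \<open>Representatives recover \<open>g\<close> from \<open>f\<close>, by evaluating
    \<open>f\<close> at one point of each class.\<close>
  define rep where "rep = (\<lambda>\<gamma>. SOME x. x \<in> V \<and> cls x = \<gamma>)"
  have rep: "rep \<gamma> \<in> V" "cls (rep \<gamma>) = \<gamma>" if "\<gamma> \<in> I" for \<gamma>
    using that someI_ex[of "\<lambda>x. x \<in> V \<and> cls x = \<gamma>"] by (auto simp: I_def rep_def)
  have finI: "finite I" using assms(1) by (simp add: I_def)
  define G where "G = {g \<in> I \<rightarrow>\<^sub>E N. (\<Sum>\<gamma>\<in>I. replicate_mset (k \<gamma>) (g \<gamma>)) = m}"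
  define F where "F = {f \<in> V \<rightarrow>\<^sub>E N. image_mset f (mset_set V) = m}"
  have finF: "finite F" unfolding F_def using assms by (simp add: finite_PiE)
  have img: "image_mset f (mset_set V) = (\<Sum>\<gamma>\<in>I. replicate_mset (k \<gamma>) (g \<gamma>))"
    if fg: "\<And>x. x \<in> V \<Longrightarrow> f x = g (cls x)" for f :: "'v \<Rightarrow> 'n" and g
  proof -
    have "image_mset f (mset_set V) = (\<Sum>x\<in>V. {#g (cls x)#})"
      using assms(1) fg by (simp add: image_mset_mset_set_conv_sum)
    also have "\<dots> = (\<Sum>\<gamma>\<in>I. \<Sum>x\<in>{x \<in> V. cls x = \<gamma>}. {#g (cls x)#})"
      unfolding I_def by (rule sum.image_gen[OF assms(1)])
    also have "\<dots> = (\<Sum>\<gamma>\<in>I. replicate_mset (k \<gamma>) (g \<gamma>))"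
    proof (intro sum.cong refl)
      fix \<gamma> assume "\<gamma> \<in> I"
      have "(\<Sum>x\<in>{x \<in> V. cls x = \<gamma>}. {#g (cls x)#}) = (\<Sum>x\<in>{x \<in> V. cls x = \<gamma>}. {#g \<gamma>#})"
        by (intro sum.cong) auto
      also have "\<dots> = replicate_mset (card {x \<in> V. cls x = \<gamma>}) (g \<gamma>)"
        using image_mset_mset_set_conv_sum[of "{x \<in> V. cls x = \<gamma>}" "\<lambda>_. g \<gamma>"] assms(1)
        by (simp add: image_mset_const_eq)
      finally show "(\<Sum>x\<in>{x \<in> V. cls x = \<gamma>}. {#g (cls x)#}) = replicate_mset (k \<gamma>) (g \<gamma>)"
        using assms(3) \<open>\<gamma> \<in> I\<close> by (simp add: I_def)
    qed
    finally show ?thesis .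
  qed
  have "(\<Sum>g\<in>I \<rightarrow>\<^sub>E N. if (\<Sum>\<gamma>\<in>I. replicate_mset (k \<gamma>) (g \<gamma>)) = m then c else 0) = (\<Sum>g\<in>G. c)"
    unfolding G_def using finI assms(2) by (intro sum.inter_filter[symmetric] finite_PiE) auto
  also have "\<dots> = (\<Sum>f\<in>{f \<in> F. \<forall>x\<in>V. \<forall>y\<in>V. cls x = cls y \<longrightarrow> f x = f y}. c)"
  proof (rule sum.reindex_bij_witness[where
        i = "\<lambda>f. restrict (\<lambda>\<gamma>. f (rep \<gamma>)) I" and j = "\<lambda>g. restrict (\<lambda>x. g (cls x)) V"])
    fix g assume "g \<in> G"
    then have g: "g \<in> I \<rightarrow>\<^sub>E N" "(\<Sum>\<gamma>\<in>I. replicate_mset (k \<gamma>) (g \<gamma>)) = m" by (auto simp: G_def)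
    show "restrict (\<lambda>\<gamma>. restrict (\<lambda>x. g (cls x)) V (rep \<gamma>)) I = g"
      using g(1) rep by (intro extensionalityI[of _ I]) (auto simp: PiE_def)
    have "image_mset (restrict (\<lambda>x. g (cls x)) V) (mset_set V) = m"
      using img[of "restrict (\<lambda>x. g (cls x)) V" g] g(2) by simp
    moreover have "restrict (\<lambda>x. g (cls x)) V \<in> V \<rightarrow>\<^sub>E N"
      using g(1) by (auto simp: I_def PiE_def)
    ultimately show "restrict (\<lambda>x. g (cls x)) V \<in> {f \<in> F. \<forall>x\<in>V. \<forall>y\<in>V. cls x = cls y \<longrightarrow> f x = f y}"
      by (auto simp: F_def)
  next
    fix f assume "f \<in> {f \<in> F. \<forall>x\<in>V. \<forall>y\<in>V. cls x = cls y \<longrightarrow> f x = f y}"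
    then have f: "f \<in> V \<rightarrow>\<^sub>E N" "image_mset f (mset_set V) = m"
      and const: "\<And>x y. x \<in> V \<Longrightarrow> y \<in> V \<Longrightarrow> cls x = cls y \<Longrightarrow> f x = f y"
      unfolding F_def by blast+
    have eq: "f x = f (rep (cls x))" if "x \<in> V" for x
      using that rep[of "cls x"] by (intro const) (auto simp: I_def)
    then have eq': "f x = restrict (\<lambda>\<gamma>. f (rep \<gamma>)) I (cls x)" if "x \<in> V" for x
      using that by (simp add: I_def)
    show "restrict (\<lambda>x. restrict (\<lambda>\<gamma>. f (rep \<gamma>)) I (cls x)) V = f"
    proof (rule extensionalityI[of _ V])
      show "f \<in> extensional V" using f(1) by (simp add: PiE_def)
      show "restrict (\<lambda>x. restrict (\<lambda>\<gamma>. f (rep \<gamma>)) I (cls x)) V x = f x" if "x \<in> V" for x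
        using that eq'[OF that] by (metis restrict_apply')
    qed simp
    have "(\<Sum>\<gamma>\<in>I. replicate_mset (k \<gamma>) (restrict (\<lambda>\<gamma>. f (rep \<gamma>)) I \<gamma>)) = m"
      using img[of f "restrict (\<lambda>\<gamma>. f (rep \<gamma>)) I"] eq' f(2) by metis
    moreover have "restrict (\<lambda>\<gamma>. f (rep \<gamma>)) I \<in> I \<rightarrow>\<^sub>E N"
      using f(1) rep(1) by (auto simp: PiE_def)
    ultimately show "restrict (\<lambda>\<gamma>. f (rep \<gamma>)) I \<in> G" by (simp add: G_def)
  qed simp
  also have "\<dots> = (\<Sum>f\<in>F. if \<forall>x\<in>V. \<forall>y\<in>V. cls x = cls y \<longrightarrow> f x = f y then c else 0)"
    by (rule sum.inter_filter[OF finF])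
  finally show ?thesis by (simp only: I_def F_def)
qed

text \<open>The colour 0 is excluded because all series involved use only variables of index at
  least 1. Extensional functions on \<open>V\<close> make each colouring count once.\<close>

definition colourings :: "'v set \<Rightarrow> nat multiset \<Rightarrow> ('v \<Rightarrow> nat) set" where
  "colourings V m = {f \<in> V \<rightarrow>\<^sub>E set_mset m - {0}. image_mset f (mset_set V) = m}"

lemma finite_colourings: "finite V \<Longrightarrow> finite (colourings V m)"
  unfolding colourings_def by (simp add: finite_PiE)

lemma mfps_coeff_power_sum_cycle_type:
  assumes "\<sigma> permutes V" "finite V"
  shows "mfps_coeff (power_sum_partition (cycle_type V \<sigma>) :: 'k::{comm_ring, comm_monoid_mult} mfps) m =
    (\<Sum>f\<in>colourings V m.
       if \<forall>x\<in>V. \<forall>y\<in>V. rotation_class (support \<sigma> x) = rotation_class (support \<sigma> y) \<longrightarrow> f x = f y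
       then 1 else 0)"
proof -
  have perm: "permutation \<sigma>" using assms unfolding permutation_permutes by blast
  define cls where "cls = (\<lambda>x. rotation_class (support \<sigma> x))"
  have cycles: "cycles V \<sigma> = cls ` V" unfolding cls_def by (rule cycles_conv_image)
  have len: "cycle_length (cls x) = length (support \<sigma> x)" for x
    unfolding cls_def by (rule cycle_length_rotation_class)
  \<comment> \<open>The points whose class is that of \<open>x\<close> are exactly the entries of
    the distinct list \<open>support \<sigma> x\<close>.\<close>
  have card: "cycle_length \<gamma> = card {x \<in> V. cls x = \<gamma>}" if \<gamma>: "\<gamma> \<in> cls ` V" for \<gamma>
  proof -
    obtain x where x: "x \<in> V" "\<gamma> = cls x" using \<gamma> by blast
    have "{y \<in> V. cls y = \<gamma>} = {y \<in> V. cls x = cls y}" using x by auto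
    also have "\<dots> = {y \<in> V. y \<in> set (support \<sigma> x)}"
      unfolding cls_def rotation_class_support_eq_iff[OF perm] ..
    also have "\<dots> = set (support \<sigma> x)" using set_support_subset[OF assms(1) x(1)] by blast
    finally show ?thesis
      unfolding x(2) len using distinct_card[OF cycle_of_permutation[OF perm, of x]] by simp
  qed
  have pos: "cycle_length \<gamma> > 0" if "\<gamma> \<in> cls ` V" for \<gamma>
  proof -
    obtain x where x: "\<gamma> = cls x" using \<open>\<gamma> \<in> cls ` V\<close> by blast
    show ?thesis
      unfolding x len using support_nonempty[OF perm, of x] by (rule length_greater_0_conv[THEN iffD2])
  qed
  have "power_sum_partition (cycle_type V \<sigma>) = (\<Prod>\<gamma>\<in>cls ` V. power_sum (cycle_length \<gamma>) :: 'k mfps)"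
    by (simp add: power_sum_partition_def cycle_type_def cycles prod_unfold_prod_mset
        image_mset.compositionality comp_def)
  also have "mfps_coeff \<dots> m = (\<Sum>g\<in>cls ` V \<rightarrow>\<^sub>E set_mset m - {0}.
      if (\<Sum>\<gamma>\<in>cls ` V. replicate_mset (cycle_length \<gamma>) (g \<gamma>)) = m then 1 else 0)"
    using assms(2) pos by (intro mfps_coeff_prod_power_sum) auto
  also have "\<dots> = (\<Sum>f\<in>colourings V m. if \<forall>x\<in>V. \<forall>y\<in>V. cls x = cls y \<longrightarrow> f x = f y then 1 else 0)"
    unfolding colourings_def using assms(2) card by (intro sum_class_colourings) auto
  finally show ?thesis by (simp only: cls_def)
qed

section \<open>Coefficients of the deformed series\<close>

lemma mfps_coeff_infsum_sorted:
  "mfps_coeff (mfps_infsum (\<lambda>is. mfps_const (c is :: 'k::{comm_ring, comm_monoid_mult}) * (\<Prod>i\<leftarrow>is. mfps_X i))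
      {is. length is = n \<and> sorted is \<and> (\<forall>i\<in>set is. 1 \<le> i)}) m =
    (if size m = n \<and> 0 \<notin># m then c (sorted_list_of_multiset m) else 0)"
proof -
  define A where "A = {is :: nat list. length is = n \<and> sorted is \<and> (\<forall>i\<in>set is. 1 \<le> i)}"
  define l where "l = sorted_list_of_multiset m"
  define h where "h = (\<lambda>is. if m = mset is then c is else 0)"
  \<comment> \<open>A sorted list is determined by its multiset, so the infinite sum has at most one
    term with monomial \<open>m\<close>.\<close>
  have eq: "is = l" if "is \<in> A" "m = mset is" for "is"
    using that by (auto simp: A_def l_def sorted_sort_id)
  have "l \<in> A \<longleftrightarrow> size m = n \<and> 0 \<notin># m"
  proof -
    have "length l = size m" "set l = set_mset m" "sorted l"
      by (metis l_def mset_sorted_list_of_multiset size_mset, simp_all add: l_def)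
    then show ?thesis by (auto simp: A_def Suc_le_eq intro: gr0I)
  qed
  moreover have "(\<Sum>is\<in>{is \<in> A. h is \<noteq> 0}. h is) = (if l \<in> A then c l else 0)"
  proof -
    have "{is \<in> A. h is \<noteq> 0} \<subseteq> (if l \<in> A then {l} else {})"
      using eq by (auto simp: h_def split: if_splits)
    then have "(\<Sum>is\<in>{is \<in> A. h is \<noteq> 0}. h is) = (\<Sum>is\<in>(if l \<in> A then {l} else {}). h is)"
      by (intro sum.mono_neutral_left) (auto split: if_splits)
    then show ?thesis by (simp add: h_def l_def)
  qed
  ultimately show ?thesis
    by (simp add: mfps_infsum.rep_eq mfps_coeff_const_mult mfps_coeff_monomial if_distrib[of "(*) _"]
        h_def l_def A_def cong: if_cong)
qed

text \<open>Along a fixed listing \<open>w\<close>, a colouring of content \<open>m\<close> that is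
  sorted must be the sorted list of \<open>m\<close> read off position by position. Hence the sum
  over colourings has at most one term.\<close>

lemma sum_sorted_colourings:
  fixes c :: "nat list \<Rightarrow> 'k::comm_monoid_add"
  assumes "finite V" "w \<in> permutations_of_set V"
  shows "(\<Sum>f\<in>colourings V m. if sorted (map f w) then c (map f w) else 0) =
    (if size m = card V \<and> 0 \<notin># m then c (sorted_list_of_multiset m) else 0)"
proof -
  define l where "l = sorted_list_of_multiset m"
  have w: "distinct w" "set w = V" using assms(2) by (auto dest: permutations_of_setD)
  have msetw: "mset w = mset_set V" using w by (metis mset_set_set)
  have lenw: "length w = card V" using w by (metis distinct_card)
  have map_f: "map f w = l" if "f \<in> colourings V m" "sorted (map f w)" for f
  proof -
    have "mset (map f w) = m" using that(1) by (simp add: msetw colourings_def)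
    then show ?thesis using that(2)
      unfolding l_def by (metis sorted_list_of_multiset_mset sorted_sort_id)
  qed
  show ?thesis
  proof (cases "size m = card V \<and> 0 \<notin># m")
    case True
    have l: "length l = card V" "mset l = m" "sorted l"
      using True by (auto simp: l_def simp flip: size_mset)
    \<comment> \<open>The only candidate gives the entries of \<open>w\<close> the colours in sorted
      order.\<close>
    define f0 where "f0 = restrict (\<lambda>x. the (map_of (zip w l) x)) V"
    have map_f0: "map f0 w = l"
      using w l(1) lenw by (intro nth_equalityI) (auto simp: f0_def map_of_zip_nth)
    have img: "image_mset f0 (mset_set V) = m"
      using map_f0 l(2) msetw by (metis mset_map)
    have "f0 ` V = set_mset m" using map_f0 w l(2) by (metis list.set_map set_mset_mset)
    then have f0: "f0 \<in> colourings V m"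
      using True img by (auto simp: colourings_def f0_def)
    have uniq: "f = f0" if "f \<in> colourings V m" "map f w = l" for f
    proof (rule PiE_ext)
      show "f \<in> V \<rightarrow>\<^sub>E set_mset m - {0}" "f0 \<in> V \<rightarrow>\<^sub>E set_mset m - {0}"
        using that f0 by (auto simp: colourings_def)
      show "f x = f0 x" if "x \<in> V" for x
        using \<open>map f w = l\<close> map_f0 that w(2) by (metis map_eq_conv)
    qed
    have "(\<Sum>f\<in>colourings V m. if sorted (map f w) then c (map f w) else 0) =
        (\<Sum>f\<in>colourings V m. if f = f0 then c l else 0)"
      using map_f uniq map_f0 l(3) by (intro sum.cong refl) metis
    also have "\<dots> = c l" using f0 finite_colourings[OF assms(1)] by simp
    finally show ?thesis using True by (simp add: l_def)
  next
    case False
    \<comment> \<open>Any colouring of content \<open>m\<close> forces both conditions, so in this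
      case there is none.\<close>
    have "size m = card V \<and> 0 \<notin># m" if "f \<in> colourings V m" for f
    proof -
      have f: "f \<in> V \<rightarrow>\<^sub>E set_mset m - {0}" "image_mset f (mset_set V) = m"
        using that by (auto simp: colourings_def)
      have "size m = card V" using f(2) by (metis size_image_mset size_mset_set)
      moreover have "set_mset m = f ` V" using f(2) assms(1) by (metis finite_set_mset_mset_set set_image_mset)
      ultimately show ?thesis using f(1) by (auto simp: PiE_def Pi_def)
    qed
    with False have "colourings V m = {}" by blast
    then show ?thesis unfolding if_not_P[OF False] by simp
  qed
qed

text \<open>Index lists are traded for colourings, and the sums are exchanged. The requirement that
  \<open>map f w\<close> be sorted is then absorbed by the coloured weight, which leaves an
  unrestricted sum over listings.\<close>

lemma mfps_coeff_deformed_redei_berge: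
  assumes "finite V"
  shows "mfps_coeff (deformed_redei_berge V t) m =
    (\<Sum>f\<in>colourings V m. path_sum (coloured_weight f t) V)"
proof -
  define c where "c = (\<lambda>w is. \<Prod>k | Suc k < card V \<and> is ! k = (is ! Suc k :: nat). t (w ! k, w ! Suc k) + 1)"
  have "mfps_coeff (deformed_redei_berge V t) m =
    (\<Sum>w\<in>permutations_of_set V. if size m = card V \<and> 0 \<notin># m then c w (sorted_list_of_multiset m) else 0)"
    unfolding deformed_redei_berge_def Let_def mfps_coeff_sum mfps_coeff_infsum_sorted c_def ..
  also have "\<dots> = (\<Sum>w\<in>permutations_of_set V. \<Sum>f\<in>colourings V m.
      if sorted (map f w) then c w (map f w) else 0)"
    by (intro sum.cong refl sum_sorted_colourings[OF assms, symmetric])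
  also have "\<dots> = (\<Sum>f\<in>colourings V m. \<Sum>w\<in>permutations_of_set V.
      if sorted (map f w) then c w (map f w) else 0)"
    by (rule sum.swap)
  also have "\<dots> = (\<Sum>f\<in>colourings V m. path_sum (coloured_weight f t) V)"
    unfolding path_sum_def path_weight_coloured_plus_1
  proof (intro sum.cong refl if_cong)
    fix f w assume "w \<in> permutations_of_set V"
    then have "length w = card V"
      by (rule length_finite_permutations_of_set)
    then show "c w (map f w) = (\<Prod>k | Suc k < length w \<and> f (w ! k) = f (w ! Suc k). t (w ! k, w ! Suc k) + 1)"
      unfolding c_def by (intro prod.cong) auto
  qed
  finally show ?thesis .
qed

section \<open>The power sum expansion\<close>

theorem theorem9p3:
  fixes V :: "'v set" and n :: nat
    and t s :: "'v \<times> 'v \<Rightarrow> 'k::{comm_ring, comm_monoid_mult}"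
  assumes "finite V" and "card V = n"
    and "\<And>a. a \<in> V \<times> V \<Longrightarrow> s a = t a + 1"
  shows "deformed_redei_berge V t =
    (\<Sum>\<sigma>\<in>{\<sigma>. \<sigma> permutes V}.
       mfps_const (\<Prod>\<gamma>\<in>cycles V \<sigma>. (\<Prod>a\<in>CArcs \<gamma>. s a) - (\<Prod>a\<in>CArcs \<gamma>. t a)) *
       power_sum_partition (cycle_type V \<sigma>))"
proof (rule mfps_eqI)
  fix m
  define c where "c = (\<lambda>\<sigma>. \<Prod>\<gamma>\<in>cycles V \<sigma>. (\<Prod>a\<in>CArcs \<gamma>. t a + 1) - (\<Prod>a\<in>CArcs \<gamma>. t a))"
  define const where "const = (\<lambda>\<sigma> (f :: 'v \<Rightarrow> nat).
    \<forall>x\<in>V. \<forall>y\<in>V. rotation_class (support \<sigma> x) = rotation_class (support \<sigma> y) \<longrightarrow> f x = f y)"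
  \<comment> \<open>\<open>s\<close> is known only on \<open>V \<times> V\<close>; every arc of a
    cycle lies there, since supports of points of \<open>V\<close> stay in \<open>V\<close>.\<close>
  have c: "(\<Prod>\<gamma>\<in>cycles V \<sigma>. (\<Prod>a\<in>CArcs \<gamma>. s a) - (\<Prod>a\<in>CArcs \<gamma>. t a)) = c \<sigma>"
    if \<sigma>: "\<sigma> permutes V" for \<sigma>
    unfolding c_def
  proof (intro prod.cong refl arg_cong2[of _ _ _ _ "(-)"])
    fix \<gamma> a assume "\<gamma> \<in> cycles V \<sigma>" "a \<in> CArcs \<gamma>"
    then obtain x where x: "x \<in> V" "a \<in> list_CArcs (support \<sigma> x)"
      unfolding cycles_def by (auto simp only: mem_Collect_eq CArcs_rotation_class)
    define l where "l = support \<sigma> x"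
    have "a \<in> set l \<times> set l"
      using x(2) unfolding l_def[symmetric] list_CArcs_def by (auto intro!: nth_mem mod_less_divisor)
    then have "a \<in> V \<times> V" using set_support_subset[OF \<sigma> x(1)] unfolding l_def[symmetric] by blast
    then show "s a = t a + 1" by (rule assms(3))
  qed
  \<comment> \<open>A permutation and a colouring constant on its cycles contribute the whole cycle
    product; every other pair contributes 0.\<close>
  have "mfps_coeff (\<Sum>\<sigma>\<in>{\<sigma>. \<sigma> permutes V}.
       mfps_const (\<Prod>\<gamma>\<in>cycles V \<sigma>. (\<Prod>a\<in>CArcs \<gamma>. s a) - (\<Prod>a\<in>CArcs \<gamma>. t a)) *
       power_sum_partition (cycle_type V \<sigma>)) m =
    (\<Sum>\<sigma> | \<sigma> permutes V. \<Sum>f\<in>colourings V m. if const \<sigma> f then c \<sigma> else 0)"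
    unfolding mfps_coeff_sum mfps_coeff_const_mult
  proof (intro sum.cong refl)
    fix \<sigma> assume "\<sigma> \<in> {\<sigma>. \<sigma> permutes V}"
    then have \<sigma>: "\<sigma> permutes V" by simp
    show "(\<Prod>\<gamma>\<in>cycles V \<sigma>. (\<Prod>a\<in>CArcs \<gamma>. s a) - (\<Prod>a\<in>CArcs \<gamma>. t a)) *
        mfps_coeff (power_sum_partition (cycle_type V \<sigma>)) m =
        (\<Sum>f\<in>colourings V m. if const \<sigma> f then c \<sigma> else 0)"
      unfolding c[OF \<sigma>] mfps_coeff_power_sum_cycle_type[OF \<sigma> assms(1)]
        fun_cong[OF fun_cong[OF const_def], symmetric] sum_distrib_left
      by (intro sum.cong) simp_all
  qed
  also have "\<dots> = (\<Sum>f\<in>colourings V m. \<Sum>\<sigma> | \<sigma> permutes V. if const \<sigma> f then c \<sigma> else 0)"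
    by (rule sum.swap)
  also have "\<dots> = (\<Sum>f\<in>colourings V m. cycle_sum (coloured_weight f t) V)"
    unfolding cycle_sum_coloured[OF assms(1)] c_def const_def ..
  \<comment> \<open>The identity of the two sums is applied separately for each colouring, with its
    own coloured weight.\<close>
  also have "\<dots> = mfps_coeff (deformed_redei_berge V t) m"
    using assms(1) by (simp add: mfps_coeff_deformed_redei_berge path_sum_eq_cycle_sum)
  finally show "mfps_coeff (deformed_redei_berge V t) m = mfps_coeff (\<Sum>\<sigma>\<in>{\<sigma>. \<sigma> permutes V}.
       mfps_const (\<Prod>\<gamma>\<in>cycles V \<sigma>. (\<Prod>a\<in>CArcs \<gamma>. s a) - (\<Prod>a\<in>CArcs \<gamma>. t a)) *
       power_sum_partition (cycle_type V \<sigma>)) m" ..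
qed

end
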